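(* Let $T_0,T_1$ be compatible ternary distributive operations on a set $X$, and let $T$ be the doubled ternary operation on $X\times X$, $$T((x_0,x_1),(y_0,y_1),(z_0,z_1))=\bigl(T_0(T_0(x_0,y_0,y_1),z_0,z_1),\ T_1(T_1(x_1,y_0,y_1),z_0,z_1)\bigr).$$ Let $A$ be an abelian group and let $\psi_0,\psi_1:X^3\to A$ be ternary 2-cocycles with respect to $T_0$ and $T_1$, respectively, that satisfy the compatibility conditions. Then $$\psi((x_0,x_1),(y_0,y_1),(z_0,z_1))=\psi_0(x_0,y_0,y_1)+\psi_1(x_1,y_0,y_1)+\psi_0(T_0(x_0,y_0,y_1),z_0,z_1)+\psi_1(T_1(x_1,y_0,y_1),z_0,z_1)$$ is a ternary 2-cocycle of $(X\times X,T)$.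
   Context: A ternary operation $T$ on a set $X$ is distributive if $T(T(x,y,z),u,v)=T(T(x,u,v),T(y,u,v),T(z,u,v))$ for all $x,y,z,u,v$. Ternary operations $T_0,T_1$ on $X$ are compatible if for all elements of $X$ $$T_0(T_0(x_0,y_0,y_1),z_0,z_1)=T_0(T_0(x_0,z_0,z_1),T_0(y_0,z_0,z_1),T_1(y_1,z_0,z_1)),$$ $$T_1(T_1(x_1,y_0,y_1),z_0,z_1)=T_1(T_1(x_1,z_0,z_1),T_0(y_0,z_0,z_1),T_1(y_1,z_0,z_1)).$$ A ternary 2-cocycle with respect to a ternary distributive operation $T$ on $X$ is a map $\psi:X^3\to A$ with $$\psi(x,y,z)+\psi(T(x,y,z),u,v)=\psi(x,u,v)+\psi(T(x,u,v),T(y,u,v),T(z,u,v))$$ for all $x,y,z,u,v\in X$. The compatibility conditions for $\psi_0,\psi_1$ are: for all $x_0,x_1,y_0,y_1,z_0,z_1\in X$, $$\psi_0(x_0,y_0,y_1)+\psi_1(T_1(x_1,y_0,y_1),z_0,z_1)=\psi_1(x_1,z_0,z_1)+\psi_0(T_0(x_0,z_0,z_1),T_0(y_0,z_0,z_1),T_1(y_1,z_0,z_1)),$$ $$\psi_1(x_1,y_0,y_1)+\psi_0(T_0(x_0,y_0,y_1),z_0,z_1)=\psi_0(x_0,z_0,z_1)+\psi_1(T_1(x_1,z_0,z_1),T_0(y_0,z_0,z_1),T_1(y_1,z_0,z_1)).$$ *)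

theory Defs
  imports Main
begin

text \<open>Ternary operations on a set $X$ are curried functions on a type \<open>'a\<close>.\<close>

definition ternary_distributive :: "('a \<Rightarrow> 'a \<Rightarrow> 'a \<Rightarrow> 'a) \<Rightarrow> bool" where
  "ternary_distributive T \<longleftrightarrow>
     (\<forall>x y z u v. T (T x y z) u v = T (T x u v) (T y u v) (T z u v))"

definition ternary_compatible ::
    "('a \<Rightarrow> 'a \<Rightarrow> 'a \<Rightarrow> 'a) \<Rightarrow> ('a \<Rightarrow> 'a \<Rightarrow> 'a \<Rightarrow> 'a) \<Rightarrow> bool" where
  "ternary_compatible T0 T1 \<longleftrightarrow>
     (\<forall>x0 y0 y1 z0 z1.
        T0 (T0 x0 y0 y1) z0 z1 = T0 (T0 x0 z0 z1) (T0 y0 z0 z1) (T1 y1 z0 z1)) \<and>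
     (\<forall>x1 y0 y1 z0 z1.
        T1 (T1 x1 y0 y1) z0 z1 = T1 (T1 x1 z0 z1) (T0 y0 z0 z1) (T1 y1 z0 z1))"

text \<open>Cocycles are only defined with respect to a distributive operation, so distributivity is
  part of the predicate. In particular, being a cocycle for a constructed operation
  includes the claim that this operation is distributive.\<close>

definition ternary_2cocycle ::
    "('a \<Rightarrow> 'a \<Rightarrow> 'a \<Rightarrow> 'a) \<Rightarrow> ('a \<Rightarrow> 'a \<Rightarrow> 'a \<Rightarrow> 'b::ab_group_add) \<Rightarrow> bool" where
  "ternary_2cocycle T \<psi> \<longleftrightarrow>
     ternary_distributive T \<and>
     (\<forall>x y z u v. \<psi> x y z + \<psi> (T x y z) u v
                = \<psi> x u v + \<psi> (T x u v) (T y u v) (T z u v))"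

definition cocycle_compatible ::
    "('a \<Rightarrow> 'a \<Rightarrow> 'a \<Rightarrow> 'a) \<Rightarrow> ('a \<Rightarrow> 'a \<Rightarrow> 'a \<Rightarrow> 'a) \<Rightarrow>
     ('a \<Rightarrow> 'a \<Rightarrow> 'a \<Rightarrow> 'b::ab_group_add) \<Rightarrow> ('a \<Rightarrow> 'a \<Rightarrow> 'a \<Rightarrow> 'b) \<Rightarrow> bool" where
  "cocycle_compatible T0 T1 \<psi>0 \<psi>1 \<longleftrightarrow>
     (\<forall>x0 x1 y0 y1 z0 z1.
        \<psi>0 x0 y0 y1 + \<psi>1 (T1 x1 y0 y1) z0 z1
          = \<psi>1 x1 z0 z1 + \<psi>0 (T0 x0 z0 z1) (T0 y0 z0 z1) (T1 y1 z0 z1) \<and>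
        \<psi>1 x1 y0 y1 + \<psi>0 (T0 x0 y0 y1) z0 z1
          = \<psi>0 x0 z0 z1 + \<psi>1 (T1 x1 z0 z1) (T0 y0 z0 z1) (T1 y1 z0 z1))"

fun doubled_op ::
    "('a \<Rightarrow> 'a \<Rightarrow> 'a \<Rightarrow> 'a) \<Rightarrow> ('a \<Rightarrow> 'a \<Rightarrow> 'a \<Rightarrow> 'a) \<Rightarrow>
     'a \<times> 'a \<Rightarrow> 'a \<times> 'a \<Rightarrow> 'a \<times> 'a \<Rightarrow> 'a \<times> 'a" where
  "doubled_op T0 T1 (x0, x1) (y0, y1) (z0, z1) =
     (T0 (T0 x0 y0 y1) z0 z1, T1 (T1 x1 y0 y1) z0 z1)"

fun doubled_cochain ::
    "('a \<Rightarrow> 'a \<Rightarrow> 'a \<Rightarrow> 'a) \<Rightarrow> ('a \<Rightarrow> 'a \<Rightarrow> 'a \<Rightarrow> 'a) \<Rightarrow>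
     ('a \<Rightarrow> 'a \<Rightarrow> 'a \<Rightarrow> 'b::ab_group_add) \<Rightarrow> ('a \<Rightarrow> 'a \<Rightarrow> 'a \<Rightarrow> 'b) \<Rightarrow>
     'a \<times> 'a \<Rightarrow> 'a \<times> 'a \<Rightarrow> 'a \<times> 'a \<Rightarrow> 'b" where
  "doubled_cochain T0 T1 \<psi>0 \<psi>1 (x0, x1) (y0, y1) (z0, z1) =
     \<psi>0 x0 y0 y1 + \<psi>1 x1 y0 y1 + \<psi>0 (T0 x0 y0 y1) z0 z1 + \<psi>1 (T1 x1 y0 y1) z0 z1"

end

(* The pairing (x0,x1) * (y0,y1) = (T0 x0 y0 y1, T1 x1 y0 y1) is a binary self-distributive
   operation, because T0 and T1 are compatible, and the doubled operation is (x * y) * z.  The sum of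
   the two compatibility conditions on the cochains says that
   phi x y = psi0 x0 y0 y1 + psi1 x1 y0 y1 is a binary 2-cocycle of this pairing, and the doubled
   cochain is phi x y + phi (x * y) z.  So it is enough to iterate a binary 2-cocycle. *)

theory Submission
  imports Defs
begin

text \<open>Acting by \<open>u\<close> and then by \<open>v\<close> is an endomorphism of
  \<open>p\<close>, and \<open>\<phi>\<close> satisfies a cocycle identity for this double action
  too; both ternary laws follow by applying these facts twice.\<close>

lemma ternary_2cocycle_of_binary:
  fixes p :: "'a \<Rightarrow> 'a \<Rightarrow> 'a" and \<phi> :: "'a \<Rightarrow> 'a \<Rightarrow> 'b::ab_group_add"
  assumes distrib: "\<And>x y z. p (p x y) z = p (p x z) (p y z)"
    and cocycle: "\<And>x y z. \<phi> x y + \<phi> (p x y) z = \<phi> x z + \<phi> (p x z) (p y z)"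
  shows "ternary_2cocycle (\<lambda>x y z. p (p x y) z) (\<lambda>x y z. \<phi> x y + \<phi> (p x y) z)"
proof -
  let ?T = "\<lambda>x y z. p (p x y) z"
  let ?\<psi> = "\<lambda>x y z. \<phi> x y + \<phi> (p x y) z"
  have action: "p (?T x u v) (?T y u v) = ?T (p x y) u v" for x y u v
    using distrib by metis
  have "ternary_distributive ?T"
    unfolding ternary_distributive_def action by simp
  moreover have "?\<psi> x y z + ?\<psi> (?T x y z) u v = ?\<psi> x u v + ?\<psi> (?T x u v) (?T y u v) (?T z u v)"
    for x y z u v
  proof -
    \<comment> \<open>The cocycle identity of \<open>\<phi>\<close> for the double action: it is
      used once at \<open>u\<close>, then once at \<open>v\<close> on the translated pair
      \<open>p x u\<close>, \<open>p y u\<close>.\<close>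
    have move: "\<phi> x y + ?\<psi> (p x y) u v = ?\<psi> x u v + \<phi> (?T x u v) (?T y u v)" for x y
    proof -
      have "\<phi> x y + ?\<psi> (p x y) u v = \<phi> x u + \<phi> (p x u) (p y u) + \<phi> (p (p x y) u) v"
        by (simp add: cocycle[of x y u] flip: add.assoc)
      also have "\<dots> = \<phi> x u + (\<phi> (p x u) (p y u) + \<phi> (p (p x u) (p y u)) v)"
        by (simp add: distrib[of x y u] add.assoc)
      also have "\<dots> = ?\<psi> x u v + \<phi> (?T x u v) (?T y u v)"
        by (simp add: cocycle[of "p x u" "p y u" v] add.assoc)
      finally show ?thesis .
    qed
    have "?\<psi> x y z + ?\<psi> (?T x y z) u v = \<phi> x y + (\<phi> (p x y) z + ?\<psi> (p (p x y) z) u v)"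
      by (simp add: add.assoc)
    \<comment> \<open>The double action is carried past \<open>z\<close> first; carrying it past
      \<open>y\<close> is the next step.\<close>
    also have "\<dots> = \<phi> x y + ?\<psi> (p x y) u v + \<phi> (?T (p x y) u v) (?T z u v)"
      by (simp add: move[of "p x y" z] add.assoc)
    also have "\<dots> = ?\<psi> x u v + ?\<psi> (?T x u v) (?T y u v) (?T z u v)"
      unfolding move[of x y] action by (simp only: add.assoc)
    finally show ?thesis .
  qed
  ultimately show ?thesis
    unfolding ternary_2cocycle_def by blast
qed

theorem theorem6p18:
  fixes T0 T1 :: "'a \<Rightarrow> 'a \<Rightarrow> 'a \<Rightarrow> 'a"
    and \<psi>0 \<psi>1 :: "'a \<Rightarrow> 'a \<Rightarrow> 'a \<Rightarrow> 'b::ab_group_add"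
  assumes "ternary_distributive T0"
    and "ternary_distributive T1"
    and "ternary_compatible T0 T1"
    and "ternary_2cocycle T0 \<psi>0"
    and "ternary_2cocycle T1 \<psi>1"
    and "cocycle_compatible T0 T1 \<psi>0 \<psi>1"
  shows "ternary_2cocycle (doubled_op T0 T1) (doubled_cochain T0 T1 \<psi>0 \<psi>1)"
proof -
  define p where "p = (\<lambda>(x0, x1) (y0, y1). (T0 x0 y0 y1, T1 x1 y0 y1))"
  define \<phi> where "\<phi> = (\<lambda>(x0, x1) (y0, y1). \<psi>0 x0 y0 y1 + \<psi>1 x1 y0 y1)"
  have "doubled_op T0 T1 = (\<lambda>x y z. p (p x y) z)"
    by (auto simp: fun_eq_iff p_def)
  moreover have "doubled_cochain T0 T1 \<psi>0 \<psi>1 = (\<lambda>x y z. \<phi> x y + \<phi> (p x y) z)"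
    by (auto simp: fun_eq_iff p_def \<phi>_def add.assoc)
  \<comment> \<open>The two equations of \<open>ternary_compatible\<close> are the two coordinates
    of this identity.\<close>
  moreover have "p (p x y) z = p (p x z) (p y z)" for x y z
    using assms(3) unfolding ternary_compatible_def p_def
    by (cases x; cases y; cases z) simp
  moreover have "\<phi> x y + \<phi> (p x y) z = \<phi> x z + \<phi> (p x z) (p y z)" for x y z
  proof -
    obtain x0 x1 y0 y1 z0 z1 where xyz: "x = (x0, x1)" "y = (y0, y1)" "z = (z0, z1)"
      by (cases x; cases y; cases z) simp
    have 0: "\<psi>0 x0 y0 y1 + \<psi>1 (T1 x1 y0 y1) z0 z1
        = \<psi>1 x1 z0 z1 + \<psi>0 (T0 x0 z0 z1) (T0 y0 z0 z1) (T1 y1 z0 z1)"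
      and 1: "\<psi>1 x1 y0 y1 + \<psi>0 (T0 x0 y0 y1) z0 z1
        = \<psi>0 x0 z0 z1 + \<psi>1 (T1 x1 z0 z1) (T0 y0 z0 z1) (T1 y1 z0 z1)"
      using assms(6) unfolding cocycle_compatible_def by blast+
    \<comment> \<open>Each of \<open>0\<close> and \<open>1\<close> mixes the two indices; after
      adding them, commutativity regroups the terms into values of \<open>\<phi>\<close>.\<close>
    show ?thesis
      using arg_cong2[where f = "(+)", OF 0 1]
      by (simp add: xyz p_def \<phi>_def add_ac)
  qed
  ultimately show ?thesis
    by (simp add: ternary_2cocycle_of_binary)
qed

end
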